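(* Let $h$ be a positive integer. There exist infinitely many $h$-tuples $(\alpha_1,\dots,\alpha_h)\in(\mathbb{Q}^+)^h$ with the following property: there exist an infinite set $M$ of positive integers and, for each $m\in M$, non-empty finite sets $A,B_1,\dots,B_h$ (depending on $m$) in a commutative group such that $|A|=m$, $$|A+B_i|\le (1+o(1))\,\alpha_i m\quad\text{for all }1\le i\le h,$$ and $$|A+B_1+\dots+B_h|\ \ge\ (1+o(1))\,\frac{\left(1-\frac1h\right)^{h-1}}{h}\,\alpha_1\cdots\alpha_h\, m^{2-1/h},$$ where the $o(1)$ terms tend to $0$ as $m\to\infty$ through $M$.
   Context: $\mathbb{Q}^+$ denotes the positive rationals. For non-empty finite sets in a commutative group (written additively), $A+B_1+\dots+B_h=\{a+b_1+\dots+b_h: a\in A,\ b_i\in B_i\}$, and $|S|$ denotes the cardinality of $S$. For $h=1$ the convention $0^0=1$ is used, so $(1-1/h)^{h-1}=1$. The commutative group may depend on $m$ and on the tuple $(\alpha_1,\dots,\alpha_h)$. *)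

theory Defs
  imports Complex_Main "HOL-Library.FuncSet" "HOL-Algebra.Algebra"
begin

text \<open>
  \<open>HOL-Algebra\<close> writes commutative groups multiplicatively: the sumset of two sets is
  \<^const>\<open>set_mult\<close>, and \<open>sumset_family G A B h\<close> is \<open>A + B 1 + \<dots> + B h\<close>.
\<close>

definition sumset_family ::
    "('a, 'b) monoid_scheme \<Rightarrow> 'a set \<Rightarrow> (nat \<Rightarrow> 'a set) \<Rightarrow> nat \<Rightarrow> 'a set" where
  "sumset_family G A B h =
     {a \<otimes>\<^bsub>G\<^esub> finprod G b {1..h} | a b. a \<in> A \<and> b \<in> (\<Pi> i\<in>{1..h}. B i)}"

text \<open>
  HOL cannot quantify existentially over types, so the group has to live on a fixed type. Finitely
  many elements generate a finitely generated abelian group, and each of these is isomorphic to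
  some \<open>product_group {..<k} (\<lambda>i. integer_mod_group (n i))\<close>, where \<open>n i = 0\<close> gives the integers.
  Such a group has element type \<^typ>\<open>nat \<Rightarrow> int\<close>; letting the group range over all commutative
  groups whose carrier is an arbitrary subset of this type therefore loses no generality.
\<close>

type_synonym group_on_seqs = "(nat \<Rightarrow> int) monoid"

abbreviation at_top_through :: "nat set \<Rightarrow> nat filter" where
  "at_top_through M \<equiv> inf sequentially (principal M)"

end

theory Submission
  imports Defs
begin

text \<open>
  The set \<open>A\<close> is made of a piece that absorbs each single summand and a piece that
  is small but grows as much as possible under all summands together. Work in
  \<open>\<int>/a \<times> (\<int>/l)\<^sup>h \<times> \<int>/(q+1)\<close>, let \<open>B\<^sub>i\<close> be the \<open>i\<close>-th factor \<open>\<int>/l\<close> (with \<open>B\<^sub>1\<close> moreover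
  containing the factor \<open>\<int>/a\<close>), and let \<open>A\<close> be the union of the subgroup \<open>(\<int>/l)\<^sup>h\<close> and of the
  last factor, which contributes \<open>q\<close> points isolated from each other modulo the \<open>B\<^sub>i\<close>. Ignoring
  the factor \<open>\<int>/a\<close>, the subgroup \<open>(\<int>/l)\<^sup>h\<close> absorbs every \<open>B\<^sub>i\<close>, whence
  \<open>|A + B\<^sub>i| = l^h + q l\<close>, whereas \<open>A + B\<^sub>1 + \<dots> + B\<^sub>h\<close> is the whole group, of order
  \<open>(q+1) l^h\<close>.

  With \<open>q\<close> about \<open>c l^(h-1)\<close> one gets \<open>m = |A|\<close> asymptotic to \<open>l^h\<close>, then \<open>|A + B\<^sub>i|\<close> is about
  \<open>(1+c) m\<close>, and the full sumset has about \<open>c m^(2-1/h)\<close> elements. So \<open>\<alpha>\<^sub>i = 1 + c\<close> is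
  admissible, with constant \<open>c/(1+c)^h\<close>. This is maximal at \<open>c = 1/(h-1)\<close>, where its value is
  exactly \<open>(1-1/h)^(h-1)/h\<close>; see \<open>optimal_constant\<close>. For \<open>h = 1\<close> the isolated points are
  dropped, and \<open>c = 0\<close>. The factor \<open>\<int>/a\<close> multiplies \<open>|A + B\<^sub>1|\<close> and the full sumset both by
  \<open>a\<close>, so that \<open>\<alpha>\<^sub>1\<close> may be multiplied by any positive integer \<open>a\<close>: this gives infinitely many
  tuples. The sets and their cardinalities are in \<open>sumset_construction\<close>.
\<close>

section \<open>Coordinate subgroups of products of cyclic groups\<close>

abbreviation cyclic_product :: "nat set \<Rightarrow> (nat \<Rightarrow> nat) \<Rightarrow> group_on_seqs" where
  "cyclic_product I n \<equiv> product_group I (\<lambda>i. integer_mod_group (n i))"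

definition coord_subgroup :: "nat set \<Rightarrow> (nat \<Rightarrow> nat) \<Rightarrow> nat set \<Rightarrow> (nat \<Rightarrow> int) set" where
  "coord_subgroup I n J = (\<Pi>\<^sub>E j\<in>I. if j \<in> J then {0..<int (n j)} else {0})"

definition coord_part :: "nat set \<Rightarrow> nat set \<Rightarrow> (nat \<Rightarrow> int) \<Rightarrow> nat \<Rightarrow> int" where
  "coord_part I J x = (\<lambda>j\<in>I. if j \<in> J then x j else 0)"

lemma comm_group_cyclic_product: "comm_group (cyclic_product I n)"
  by (rule group.group_comm_groupI) (auto simp: add.commute)

lemma carrier_cyclic_product:
  assumes "\<forall>j\<in>I. n j > 0"
  shows "carrier (cyclic_product I n) = coord_subgroup I n I"
proof -
  have "carrier (integer_mod_group (n j)) = {0..<int (n j)}" if "j \<in> I" for j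
    using assms that by (auto simp: carrier_integer_mod_group)
  then show ?thesis
    by (simp add: coord_subgroup_def cong: PiE_cong)
qed

lemma coord_subgroup_subset_carrier:
  assumes "\<forall>j\<in>I. n j > 0"
  shows "coord_subgroup I n J \<subseteq> carrier (cyclic_product I n)"
  unfolding carrier_cyclic_product[OF assms] unfolding coord_subgroup_def
  using assms by (intro PiE_mono) auto

lemma coord_subgroup_nonempty:
  assumes "\<forall>j\<in>I. n j > 0"
  shows "coord_subgroup I n J \<noteq> {}"
  using assms by (auto simp: coord_subgroup_def PiE_eq_empty_iff)

lemma finite_coord_subgroup: "finite I \<Longrightarrow> finite (coord_subgroup I n J)"
  unfolding coord_subgroup_def by (rule finite_PiE) auto

lemma card_coord_subgroup:
  assumes "finite I" "J \<subseteq> I"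
  shows "card (coord_subgroup I n J) = (\<Prod>j\<in>J. n j)"
proof -
  have "card (coord_subgroup I n J) = (\<Prod>j\<in>I. if j \<in> J then n j else 1)"
    unfolding coord_subgroup_def card_PiE[OF assms(1)] by (intro prod.cong) auto
  also have "\<dots> = (\<Prod>j\<in>J. n j)"
    using assms by (simp add: prod.If_cases Int_absorb1)
  finally show ?thesis .
qed

lemma coord_subgroup_Int:
  assumes "\<forall>j\<in>I. n j > 0"
  shows "coord_subgroup I n J \<inter> coord_subgroup I n K = coord_subgroup I n (J \<inter> K)"
  unfolding coord_subgroup_def PiE_Int using assms by (intro PiE_cong) auto

lemma card_Un_coord_subgroup:
  assumes "finite I" "\<forall>j\<in>I. n j > 0" "J \<subseteq> I" "K \<subseteq> I"
  shows "card (coord_subgroup I n J \<union> coord_subgroup I n K) + (\<Prod>j\<in>J \<inter> K. n j)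
    = (\<Prod>j\<in>J. n j) + (\<Prod>j\<in>K. n j)"
proof -
  have "card (coord_subgroup I n (J \<inter> K)) = (\<Prod>j\<in>J \<inter> K. n j)"
    using assms by (intro card_coord_subgroup) auto
  then show ?thesis
    using card_Un_Int[OF finite_coord_subgroup finite_coord_subgroup, of I I n J n K] assms
    by (simp add: card_coord_subgroup coord_subgroup_Int)
qed

lemma coord_subgroup_add:
  assumes "\<forall>j\<in>I. n j > 0"
    and "x \<in> coord_subgroup I n J" "y \<in> coord_subgroup I n K"
  shows "x \<otimes>\<^bsub>cyclic_product I n\<^esub> y \<in> coord_subgroup I n (J \<union> K)"
  using assms by (fastforce simp: coord_subgroup_def PiE_iff split: if_splits)

lemma coord_part_mem:
  assumes "\<forall>j\<in>I. n j > 0" "x \<in> coord_subgroup I n I"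
  shows "coord_part I J x \<in> coord_subgroup I n J"
  using assms by (auto simp: coord_subgroup_def coord_part_def PiE_iff)

lemma coord_part_add:
  assumes "x \<in> coord_subgroup I n I" "J \<inter> K = {}"
  shows "coord_part I J x \<otimes>\<^bsub>cyclic_product I n\<^esub> coord_part I K x = coord_part I (J \<union> K) x"
  using assms by (auto simp: coord_subgroup_def coord_part_def PiE_iff fun_eq_iff)

text \<open>
  Sums of elements with pairwise disjoint supports are evaluated here without a general formula
  for the coordinates of \<^const>\<open>finprod\<close> in a product group: each step adds parts of one fixed
  element with disjoint supports, so no reduction modulo \<open>n j\<close> ever takes place.
\<close>

lemma coord_part_finprod:
  fixes F :: "nat \<Rightarrow> nat set"
  assumes pos: "\<forall>j\<in>I. n j > 0" and x: "x \<in> coord_subgroup I n I"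
    and "finite S" "disjoint_family_on F S"
  shows "finprod (cyclic_product I n) (\<lambda>i. coord_part I (F i) x) S = coord_part I (\<Union>i\<in>S. F i) x"
  using assms(3,4)
proof (induction S rule: finite_induct)
  case empty
  interpret comm_group "cyclic_product I n" by (rule comm_group_cyclic_product)
  show ?case
    by (simp only: finprod_empty) (simp add: coord_part_def)
next
  case (insert s S)
  interpret comm_group "cyclic_product I n" by (rule comm_group_cyclic_product)
  have in_carrier: "coord_part I J x \<in> carrier (cyclic_product I n)" for J
    using coord_part_mem[OF pos x] coord_subgroup_subset_carrier[OF pos] by blast
  have "F s \<inter> (\<Union>i\<in>S. F i) = {}"
    using insert.prems insert.hyps by (fastforce simp: disjoint_family_on_def)
  moreover have "disjoint_family_on F S"
    using insert.prems by (rule disjoint_family_on_mono[rotated]) auto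
  moreover have "finprod (cyclic_product I n) (\<lambda>i. coord_part I (F i) x) (insert s S)
      = coord_part I (F s) x \<otimes>\<^bsub>cyclic_product I n\<^esub>
        finprod (cyclic_product I n) (\<lambda>i. coord_part I (F i) x) S"
    using insert.hyps in_carrier by (intro finprod_insert Pi_I)
  ultimately show ?case
    using insert.IH coord_part_add[OF x, of "F s" "\<Union>i\<in>S. F i"] by (simp only: UN_insert)
qed

text \<open>
  Once the supports of \<open>A\<close> and of the \<open>B i\<close> partition the coordinates, cutting an element along
  this partition writes it as a sum. This is why the full sumset is the whole group.
\<close>

lemma coord_subgroup_subset_sumset_family:
  assumes pos: "\<forall>j\<in>I. n j > 0"
    and A: "coord_subgroup I n J \<subseteq> A"
    and disj: "disjoint_family_on F {1..h}" "J \<inter> (\<Union>i\<in>{1..h}. F i) = {}"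
    and cover: "I \<subseteq> J \<union> (\<Union>i\<in>{1..h}. F i)"
  shows "coord_subgroup I n I \<subseteq>
    sumset_family (cyclic_product I n) A (\<lambda>i. coord_subgroup I n (F i)) h"
proof
  fix x assume x: "x \<in> coord_subgroup I n I"
  let ?b = "\<lambda>i. coord_part I (F i) x"
  have "coord_part I J x \<otimes>\<^bsub>cyclic_product I n\<^esub> finprod (cyclic_product I n) ?b {1..h}
      = coord_part I (J \<union> (\<Union>i\<in>{1..h}. F i)) x"
    unfolding coord_part_finprod[OF pos x finite_atLeastAtMost disj(1)]
    by (rule coord_part_add[OF x disj(2)])
  also have "\<dots> = x"
    using x cover by (fastforce simp: coord_part_def coord_subgroup_def PiE_iff extensional_def fun_eq_iff)
  finally have "x = coord_part I J x \<otimes>\<^bsub>cyclic_product I n\<^esub>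
      finprod (cyclic_product I n) ?b {1..h}" by simp
  moreover have "coord_part I J x \<in> A"
    using A coord_part_mem[OF pos x] by blast
  moreover have "?b \<in> (\<Pi> i\<in>{1..h}. coord_subgroup I n (F i))"
    using coord_part_mem[OF pos x] by auto
  ultimately show "x \<in> sumset_family (cyclic_product I n) A (\<lambda>i. coord_subgroup I n (F i)) h"
    unfolding sumset_family_def by blast
qed

section \<open>The sets\<close>

text \<open>
  Coordinate \<open>0\<close> carries the factor that rescales \<open>\<alpha>\<^sub>1\<close>, coordinates \<open>1, \<dots>, h\<close> the cube, and
  coordinate \<open>h + 1\<close> the isolated points; the last modulus is \<open>q + 1\<close> because \<open>0\<close> already belongs
  to the cube.
\<close>

definition moduli :: "nat \<Rightarrow> nat \<Rightarrow> nat \<Rightarrow> nat \<Rightarrow> nat \<Rightarrow> nat" where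
  "moduli h a l q j = (if j = 0 then a else if j \<le> h then l else Suc q)"

definition summand_coords :: "nat \<Rightarrow> nat set" where
  "summand_coords i = (if i = 1 then {0, 1} else {i})"

text \<open>
  Adding the subgroup \<open>B i\<close> to \<open>A\<close> gives a union of two coordinate subgroups again, one from the
  cube and one from the isolated points, and they meet exactly in \<open>B i\<close>. Subtracting this
  intersection turns the \<open>q + 1\<close> translates of \<open>B i\<close> in the second one into \<open>q\<close> new ones, which
  explains the exact form of the bounds.
\<close>

lemma sumset_construction:
  fixes h a l q :: nat
  assumes "h \<ge> 1" "a \<ge> 1" "l \<ge> 1"
  defines "n \<equiv> moduli h a l q"
  defines "G \<equiv> cyclic_product {..Suc h} n"
    and "A \<equiv> coord_subgroup {..Suc h} n {1..h} \<union> coord_subgroup {..Suc h} n {Suc h}"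
    and "B \<equiv> \<lambda>i. coord_subgroup {..Suc h} n (summand_coords i)"
  shows "comm_group G"
    and "A \<subseteq> carrier G" "finite A" "A \<noteq> {}"
    and "B i \<subseteq> carrier G" "finite (B i)" "B i \<noteq> {}"
    and "card A = l ^ h + q"
    and "i \<in> {1..h} \<Longrightarrow> card (A <#>\<^bsub>G\<^esub> B i) \<le> (if i = 1 then a else 1) * (l ^ h + q * l)"
    and "card (sumset_family G A B h) \<ge> a * l ^ h * Suc q"
proof -
  let ?I = "{..Suc h}" and ?F = summand_coords
  have pos: "\<forall>j\<in>?I. n j > 0"
    using assms(2,3) by (simp add: n_def moduli_def)
  have box: "(\<Prod>j\<in>{1..h}. n j) = l ^ h"
  proof -
    have "(\<Prod>j\<in>{1..h}. n j) = (\<Prod>j\<in>{1..h}. l)"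
      by (rule prod.cong) (auto simp: n_def moduli_def)
    then show ?thesis by simp
  qed
  have n0: "n 0 = a" and nSuc: "n (Suc h) = Suc q" and n_mid: "\<And>i. i \<in> {1..h} \<Longrightarrow> n i = l"
    by (auto simp: n_def moduli_def)
  show "comm_group G"
    unfolding G_def by (rule comm_group_cyclic_product)
  show A: "A \<subseteq> carrier G"
    unfolding A_def G_def using coord_subgroup_subset_carrier[OF pos] by blast
  show "finite A"
    unfolding A_def by (simp add: finite_coord_subgroup)
  show "A \<noteq> {}"
    unfolding A_def using coord_subgroup_nonempty[OF pos] by simp
  show B: "B i \<subseteq> carrier G" for i
    unfolding B_def G_def by (rule coord_subgroup_subset_carrier[OF pos])
  show "finite (B i)"
    unfolding B_def by (simp add: finite_coord_subgroup)
  show "B i \<noteq> {}"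
    unfolding B_def by (rule coord_subgroup_nonempty[OF pos])
  show "card A = l ^ h + q"
    using card_Un_coord_subgroup[of ?I n "{1..h}" "{Suc h}"] pos box nSuc
    by (auto simp: A_def)
  show "card (A <#>\<^bsub>G\<^esub> B i) \<le> (if i = 1 then a else 1) * (l ^ h + q * l)" if i: "i \<in> {1..h}"
  proof -
    let ?a = "if i = 1 then a else 1"
    let ?U = "coord_subgroup ?I n ({1..h} \<union> ?F i) \<union> coord_subgroup ?I n ({Suc h} \<union> ?F i)"
    have "A <#>\<^bsub>G\<^esub> B i \<subseteq> ?U"
      using coord_subgroup_add[OF pos]
      unfolding set_mult_def A_def B_def G_def by blast
    then have le: "card (A <#>\<^bsub>G\<^esub> B i) \<le> card ?U"
      by (intro card_mono) (simp_all add: finite_coord_subgroup)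
    have F: "(\<Prod>j\<in>?F i. n j) = ?a * l"
      using n_mid[OF i] by (auto simp: summand_coords_def n0)
    have "({1..h} \<union> ?F i) = (if i = 1 then insert 0 {1..h} else {1..h})"
      using i by (auto simp: summand_coords_def)
    then have 1: "(\<Prod>j\<in>{1..h} \<union> ?F i. n j) = ?a * l ^ h"
      using box n0 by simp
    have "Suc h \<notin> ?F i" "finite (?F i)"
      using i by (auto simp: summand_coords_def)
    then have 2: "(\<Prod>j\<in>{Suc h} \<union> ?F i. n j) = Suc q * (?a * l)"
      using F nSuc by simp
    have 3: "({1..h} \<union> ?F i) \<inter> ({Suc h} \<union> ?F i) = ?F i"
      using i by (auto simp: summand_coords_def)
    have "card ?U + ?a * l = ?a * l ^ h + Suc q * (?a * l)"
      using card_Un_coord_subgroup[of ?I n "{1..h} \<union> ?F i" "{Suc h} \<union> ?F i"] pos i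
      unfolding 1 2 3 F by (auto simp: summand_coords_def split: if_splits)
    then have "card ?U = ?a * (l ^ h + q * l)"
      by (simp add: algebra_simps split: if_splits)
    with le show ?thesis by simp
  qed
  show "card (sumset_family G A B h) \<ge> a * l ^ h * Suc q"
  proof -
    interpret G: comm_group G by fact
    have "disjoint_family_on ?F {1..h}"
      by (auto simp: disjoint_family_on_def summand_coords_def)
    moreover have "{Suc h} \<inter> (\<Union>i\<in>{1..h}. ?F i) = {}"
      by (auto simp: summand_coords_def split: if_splits)
    moreover have "?I \<subseteq> {Suc h} \<union> (\<Union>i\<in>{1..h}. ?F i)"
    proof
      fix j assume "j \<in> ?I"
      then consider "j = 0" | "j \<in> {1..h}" | "j = Suc h" by fastforce
      then show "j \<in> {Suc h} \<union> (\<Union>i\<in>{1..h}. ?F i)"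
      proof cases
        case 1
        then have "j \<in> ?F 1" by (simp add: summand_coords_def)
        with assms(1) show ?thesis by fastforce
      next
        case 2
        then have "j \<in> ?F j" by (simp add: summand_coords_def)
        with 2 show ?thesis by fastforce
      qed simp
    qed
    ultimately have "coord_subgroup ?I n ?I \<subseteq> sumset_family G A B h"
      unfolding G_def B_def A_def by (intro coord_subgroup_subset_sumset_family[where J = "{Suc h}"] pos) auto
    moreover have "sumset_family G A B h \<subseteq> carrier G"
    proof
      fix x assume "x \<in> sumset_family G A B h"
      then obtain a' b where "x = a' \<otimes>\<^bsub>G\<^esub> finprod G b {1..h}" "a' \<in> A" "b \<in> (\<Pi> i\<in>{1..h}. B i)"
        unfolding sumset_family_def by blast
      with A B show "x \<in> carrier G"
        by (auto intro!: G.m_closed G.finprod_closed)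
    qed
    moreover have "finite (carrier G)"
      unfolding G_def carrier_cyclic_product[OF pos] by (simp add: finite_coord_subgroup)
    ultimately have "card (coord_subgroup ?I n ?I) \<le> card (sumset_family G A B h)"
      by (meson card_mono finite_subset)
    moreover have "?I = insert 0 (insert (Suc h) {1..h})"
      by auto
    then have "(\<Prod>j\<in>?I. n j) = a * (Suc q * l ^ h)"
      using box n0 nSuc by simp
    ultimately show ?thesis
      by (simp add: card_coord_subgroup mult_ac)
  qed
qed

section \<open>The choice of parameters\<close>

text \<open>
  For \<open>h = 1\<close> the division by zero yields \<open>0\<close>: no isolated points. This agrees with
  \<open>c = inverse (h - 1) = 0\<close>, so the lemmas below cover \<open>h = 1\<close> uniformly.
\<close>

definition isolated_points :: "nat \<Rightarrow> nat \<Rightarrow> nat" where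
  "isolated_points h l = l ^ (h - 1) div (h - 1)"

definition base_size :: "nat \<Rightarrow> nat \<Rightarrow> nat" where
  "base_size h l = l ^ h + isolated_points h l"

lemma isolated_points_le: "real (isolated_points h l) \<le> inverse (real (h - 1)) * real l ^ (h - 1)"
proof -
  have "real (isolated_points h l) \<le> real (l ^ (h - 1)) / real (h - 1)"
    unfolding isolated_points_def by (rule of_nat_div_le_of_nat)
  then show ?thesis by (simp add: field_simps)
qed

lemma isolated_points_le_power: "isolated_points h l \<le> l ^ (h - 1)"
  by (simp add: isolated_points_def)

text \<open>
  For \<open>h > 1\<close>, the coefficient of \<open>l ^ (h - 1)\<close> equals \<open>1 / (h - 1)\<close>, and rounding
  \<open>l ^ (h - 1) / (h - 1)\<close> down and adding one does not decrease it.
  Hence the lower bound for the full sumset needs no error term for this rounding.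
\<close>

lemma optimal_constant:
  assumes "h \<ge> 1" "l \<ge> 1"
  shows "(1 - 1 / real h) ^ (h - 1) / real h * (1 + inverse (real (h - 1))) ^ h * real l ^ (h - 1)
    \<le> real (Suc (isolated_points h l))"
proof (cases "h = 1")
  case True
  then show ?thesis by simp
next
  case False
  then obtain k where h: "h = Suc k" "k > 0"
    using assms by (cases h) auto
  have coefficient: "(1 - 1 / real h) ^ (h - 1) / real h * (1 + inverse (real (h - 1))) ^ h = inverse (real k)"
  proof -
    have 1: "1 - 1 / real h = real k / (real k + 1)" and 2: "1 + inverse (real k) = (real k + 1) / real k"
      using h by (auto simp: field_simps)
    show ?thesis
      using h(2) unfolding 1 unfolding h(1) diff_Suc_1 2
      by (simp add: power_divide divide_simps)
  qed
  have "real l ^ k / real k \<le> real (Suc (l ^ k div k))"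
  proof -
    have "l ^ k < k * Suc (l ^ k div k)"
      using dividend_less_times_div[OF h(2)] by simp
    then have "real (l ^ k) \<le> real (k * Suc (l ^ k div k))"
      by (intro of_nat_mono) simp
    then show ?thesis using h(2) by (simp add: field_simps)
  qed
  then show ?thesis
    unfolding coefficient unfolding isolated_points_def h(1) diff_Suc_1 by (simp add: field_simps)
qed

lemma strict_mono_base_size:
  assumes "h \<ge> 1"
  shows "strict_mono (base_size h)"
proof (rule strict_monoI)
  fix x y :: nat assume "x < y"
  then have "x ^ h < y ^ h" "x ^ (h - 1) \<le> y ^ (h - 1)"
    using assms by (auto intro: power_strict_mono power_mono)
  then show "base_size h x < base_size h y"
    unfolding base_size_def isolated_points_def by (intro add_less_le_mono div_le_mono)
qed

lemma base_size_ratio: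
  assumes "h \<ge> 1"
  shows "(\<lambda>l. real l ^ h / real (base_size h l)) \<longlonglongrightarrow> 1"
proof -
  have "(\<lambda>l. real (base_size h l) / real l ^ h) \<longlonglongrightarrow> 1"
  proof (rule tendsto_sandwich[where f = "\<lambda>_. 1" and h = "\<lambda>l. 1 + 1 / real l"])
    show "\<forall>\<^sub>F l in sequentially. 1 \<le> real (base_size h l) / real l ^ h"
      using eventually_gt_at_top[of 0] by eventually_elim (simp add: base_size_def field_simps)
    show "\<forall>\<^sub>F l in sequentially. real (base_size h l) / real l ^ h \<le> 1 + 1 / real l"
      using eventually_gt_at_top[of 0]
    proof eventually_elim
      case (elim l)
      have "real (isolated_points h l) \<le> real l ^ (h - 1)"
        using isolated_points_le_power[of h l] by (metis of_nat_le_iff of_nat_power)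
      moreover have "real l ^ h = real l * real l ^ (h - 1)"
        using assms by (simp add: power_eq_if)
      ultimately show ?case
        using elim by (simp add: base_size_def field_simps)
    qed
    show "(\<lambda>l. 1 + 1 / real l) \<longlonglongrightarrow> 1"
      using tendsto_add[OF tendsto_const lim_1_over_n, of "1 :: real"] by simp
  qed simp
  from tendsto_inverse[OF this] show ?thesis
    by (simp add: inverse_eq_divide)
qed

text \<open>
  Error terms are functions of the side \<open>l\<close> of the cube, while the limits are taken along the
  sizes \<open>m\<close> of \<open>A\<close>; this lemma transfers limits from \<open>l\<close> to \<open>m\<close>.
\<close>

lemma filterlim_inv_at_top_through_range:
  fixes f g :: "nat \<Rightarrow> nat"
  assumes "strict_mono f" "\<And>l. g (f l) = l"
  shows "filterlim g sequentially (at_top_through (f ` S))"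
  unfolding filterlim_at_top
proof
  fix N
  have "N \<le> g m" if "m \<in> f ` S" "m \<ge> f N" for m
    using that assms strict_mono_less_eq[OF assms(1)] by auto
  then show "\<forall>\<^sub>F m in at_top_through (f ` S). N \<le> g m"
    unfolding eventually_inf_principal eventually_sequentially by blast
qed

lemma power_powr_two_minus_inverse:
  assumes "h \<ge> 1" "l \<ge> 1"
  shows "(real l ^ h) powr (2 - 1 / real h) = real l ^ h * real l ^ (h - 1)"
proof -
  have "(real l ^ h) powr (2 - 1 / real h) = real l powr (real h * (2 - 1 / real h))"
    using assms by (simp add: powr_powr flip: powr_realpow)
  also have "real h * (2 - 1 / real h) = real h + real (h - 1)"
    using assms by (simp add: field_simps of_nat_diff)
  also have "real l powr \<dots> = real l ^ h * real l ^ (h - 1)"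
  proof -
    have "real l > 0" using assms(2) by simp
    then show ?thesis by (simp only: powr_add powr_realpow)
  qed
  finally show ?thesis .
qed

section \<open>Infinitely many tuples\<close>

theorem mainTheorem2:
  fixes h :: nat
  assumes "h \<ge> 1"
  shows "infinite {\<alpha> :: nat \<Rightarrow> rat. \<alpha> \<in> {1..h} \<rightarrow>\<^sub>E {q. 0 < q} \<and>
    (\<exists>M :: nat set. infinite M \<and> (\<forall>m\<in>M. m > 0) \<and>
      (\<exists>(G :: nat \<Rightarrow> group_on_seqs) (A :: nat \<Rightarrow> (nat \<Rightarrow> int) set)
         (B :: nat \<Rightarrow> nat \<Rightarrow> (nat \<Rightarrow> int) set)
         (\<epsilon> :: nat \<Rightarrow> nat \<Rightarrow> real) (\<delta> :: nat \<Rightarrow> real).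
        (\<forall>i\<in>{1..h}. (\<epsilon> i \<longlongrightarrow> 0) (at_top_through M)) \<and>
        (\<delta> \<longlongrightarrow> 0) (at_top_through M) \<and>
        (\<forall>m\<in>M.
          comm_group (G m) \<and>
          A m \<subseteq> carrier (G m) \<and> finite (A m) \<and> A m \<noteq> {} \<and>
          (\<forall>i\<in>{1..h}. B m i \<subseteq> carrier (G m) \<and> finite (B m i) \<and> B m i \<noteq> {}) \<and>
          card (A m) = m \<and>
          (\<forall>i\<in>{1..h}.
            real (card (A m <#>\<^bsub>G m\<^esub> B m i)) \<le> (1 + \<epsilon> i m) * real_of_rat (\<alpha> i) * real m) \<and>
          real (card (sumset_family (G m) (A m) (B m) h)) \<ge>
            (1 + \<delta> m) * ((1 - 1 / real h) ^ (h - 1) / real h) *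
            (\<Prod>i\<in>{1..h}. real_of_rat (\<alpha> i)) * real m powr (2 - 1 / real h))))}" (is "infinite ?T")
proof -
  define c where "c = inverse (of_nat (h - 1) :: rat)"
  define \<alpha> where "\<alpha> = (\<lambda>a::nat. \<lambda>i\<in>{1..h}. (1 + c) * of_nat (if i = 1 then a else 1))"
  have c: "c \<ge> 0" "real_of_rat c = inverse (real (h - 1))"
    by (simp_all add: c_def of_rat_inverse)
  have \<alpha>: "real_of_rat (\<alpha> a i) = (1 + real_of_rat c) * real (if i = 1 then a else 1)"
    if "i \<in> {1..h}" for a i
    using that by (simp add: \<alpha>_def of_rat_mult of_rat_add)
  have prod_\<alpha>: "(\<Prod>i\<in>{1..h}. real_of_rat (\<alpha> a i)) = (1 + real_of_rat c) ^ h * real a" for a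
  proof -
    have "(\<Prod>i\<in>{1..h}. real_of_rat (\<alpha> a i))
        = (\<Prod>i\<in>{1..h}. (1 + real_of_rat c) * (if i = 1 then real a else 1))"
      by (intro prod.cong) (auto simp: \<alpha>)
    then show ?thesis
      unfolding prod.distrib using assms by simp
  qed
  have "inj_on \<alpha> {1..}"
  proof (rule inj_onI)
    fix x y assume "\<alpha> x = \<alpha> y"
    then have "\<alpha> x 1 = \<alpha> y 1" by simp
    then show "x = y" using assms c(1) by (auto simp: \<alpha>_def)
  qed
  then have "infinite (\<alpha> ` {1..})"
    using finite_imageD infinite_Ici by blast
  moreover have "\<alpha> a \<in> ?T" if a: "a \<ge> 1" for a
  proof -
    define f where "f = base_size h"
    define g where "g = inv_into UNIV f"
    define M where "M = f ` {1..}"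
    define n where "n m = moduli h a (g m) (isolated_points h (g m))" for m
    define G where "G m = cyclic_product {..Suc h} (n m)" for m
    define A where "A m = coord_subgroup {..Suc h} (n m) {1..h}
      \<union> coord_subgroup {..Suc h} (n m) {Suc h}" for m
    define B where "B m i = coord_subgroup {..Suc h} (n m) (summand_coords i)" for m i
    define e where "e = 2 - 1 / real h"
    \<comment> \<open>The only error term: it replaces \<open>m\<close> by \<open>l ^ h\<close> in the power \<open>m powr (2 - 1 / h)\<close>.\<close>
    define \<delta> where "\<delta> = (\<lambda>m. (real (g m) ^ h / real (f (g m))) powr e - 1)"
    have f: "strict_mono f"
      unfolding f_def using assms by (rule strict_mono_base_size)
    have gf: "g (f l) = l" for l
      unfolding g_def using strict_mono_imp_inj_on[OF f] by simp
    have "\<alpha> a \<in> {1..h} \<rightarrow>\<^sub>E {q. 0 < q}"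
      using a c(1) by (auto simp: \<alpha>_def)
    moreover have "infinite M"
      unfolding M_def using finite_imageD[OF _ strict_mono_imp_inj_on[OF f, of "{1..}"]] infinite_Ici
      by blast
    moreover have "(\<delta> \<longlongrightarrow> 0) (at_top_through M)"
    proof -
      have "(\<lambda>l. (real l ^ h / real (f l)) powr e - 1) \<longlonglongrightarrow> 1 powr e - 1"
        unfolding f_def using assms by (intro tendsto_intros base_size_ratio) auto
      then have "(\<lambda>l. (real l ^ h / real (f l)) powr e - 1) \<longlonglongrightarrow> 0"
        by simp
      from filterlim_compose[OF this filterlim_inv_at_top_through_range[OF f gf]]
      show ?thesis
        unfolding \<delta>_def M_def .
    qed
    moreover have "m > 0 \<and> comm_group (G m) \<and>
          A m \<subseteq> carrier (G m) \<and> finite (A m) \<and> A m \<noteq> {} \<and>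
          (\<forall>i\<in>{1..h}. B m i \<subseteq> carrier (G m) \<and> finite (B m i) \<and> B m i \<noteq> {}) \<and>
          card (A m) = m \<and>
          (\<forall>i\<in>{1..h}.
            real (card (A m <#>\<^bsub>G m\<^esub> B m i)) \<le> (1 + 0) * real_of_rat (\<alpha> a i) * real m) \<and>
          real (card (sumset_family (G m) (A m) (B m) h)) \<ge>
            (1 + \<delta> m) * ((1 - 1 / real h) ^ (h - 1) / real h) *
            (\<Prod>i\<in>{1..h}. real_of_rat (\<alpha> a i)) * real m powr (2 - 1 / real h)"
      if "m \<in> M" for m
    proof -
      define l where "l = g m"
      define q where "q = isolated_points h l"
      have l: "l \<ge> 1" "m = f l"
        using that by (auto simp: M_def l_def gf)
      have m: "m = l ^ h + q"
        by (simp add: l(2) f_def q_def base_size_def)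
      have m_pos: "m > 0"
        using l(1) by (simp add: m)
      have n: "n m = moduli h a l q"
        by (simp only: n_def q_def l_def)
      note construction = sumset_construction[OF assms a l(1), where q = q,
          folded n, folded G_def, folded A_def, folded B_def]
      have card_A: "card (A m) = m"
        unfolding construction(8) by (rule m[symmetric])
      have upper: "real (card (A m <#>\<^bsub>G m\<^esub> B m i)) \<le> (1 + 0) * real_of_rat (\<alpha> a i) * real m"
        if i: "i \<in> {1..h}" for i
      proof -
        let ?a = "if i = 1 then a else 1"
        have "real q * real l \<le> real_of_rat c * real l ^ h"
        proof -
          have "real q * real l \<le> (real_of_rat c * real l ^ (h - 1)) * real l"
            unfolding q_def c(2) by (intro mult_right_mono isolated_points_le) simp
          also have "\<dots> = real_of_rat c * real l ^ h"
            using assms by (simp add: power_eq_if)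
          finally show ?thesis .
        qed
        then have "real (l ^ h + q * l) \<le> (1 + real_of_rat c) * real l ^ h"
          by (simp add: algebra_simps)
        also have "\<dots> \<le> (1 + real_of_rat c) * real m"
          using c by (intro mult_left_mono) (simp_all add: m)
        finally have "real ?a * real (l ^ h + q * l) \<le> real ?a * ((1 + real_of_rat c) * real m)"
          by (intro mult_left_mono) simp_all
        moreover have "real (card (A m <#>\<^bsub>G m\<^esub> B m i)) \<le> real ?a * real (l ^ h + q * l)"
          using construction(9)[OF i] unfolding of_nat_mult[symmetric] of_nat_le_iff .
        ultimately show ?thesis
          using i by (simp add: \<alpha> mult_ac)
      qed
      have lower: "real (card (sumset_family (G m) (A m) (B m) h)) \<ge>
            (1 + \<delta> m) * ((1 - 1 / real h) ^ (h - 1) / real h) *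
            (\<Prod>i\<in>{1..h}. real_of_rat (\<alpha> a i)) * real m powr (2 - 1 / real h)"
      proof -
        let ?\<kappa> = "(1 - 1 / real h) ^ (h - 1) / real h"
        have "(1 + \<delta> m) * real m powr (2 - 1 / real h) = (real l ^ h) powr e"
          using m_pos l(2)[symmetric] by (simp add: \<delta>_def e_def powr_divide flip: l_def)
        also have "\<dots> = real l ^ h * real l ^ (h - 1)"
          unfolding e_def using assms l(1) by (rule power_powr_two_minus_inverse)
        finally have scale: "(1 + \<delta> m) * real m powr (2 - 1 / real h) = real l ^ h * real l ^ (h - 1)" .
        have "(1 + \<delta> m) * ?\<kappa> * (\<Prod>i\<in>{1..h}. real_of_rat (\<alpha> a i)) * real m powr (2 - 1 / real h)
            = ((1 + \<delta> m) * real m powr (2 - 1 / real h)) *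
              (?\<kappa> * ((1 + inverse (real (h - 1))) ^ h * real a))"
          unfolding prod_\<alpha> c(2) by (simp only: mult_ac)
        also have "\<dots> = (real a * real l ^ h) * (?\<kappa> * (1 + inverse (real (h - 1))) ^ h * real l ^ (h - 1))"
          unfolding scale by (simp only: mult_ac)
        also have "\<dots> \<le> (real a * real l ^ h) * real (Suc q)"
          unfolding q_def by (intro mult_left_mono optimal_constant assms l(1)) simp
        also have "\<dots> = real (a * l ^ h * Suc q)"
          by (simp only: of_nat_mult of_nat_power)
        also have "\<dots> \<le> real (card (sumset_family (G m) (A m) (B m) h))"
          using construction(10) unfolding of_nat_le_iff .
        finally show ?thesis .
      qed
      show ?thesis
        using m_pos construction(1-7) card_A upper lower by blast
    qed
    ultimately show ?thesis
      unfolding mem_Collect_eq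
      by (intro conjI exI[of _ M] exI[of _ G] exI[of _ A] exI[of _ B] exI[of _ "\<lambda>_ _. 0"]
          exI[of _ \<delta>] ballI tendsto_const) simp_all
  qed
  then have "\<alpha> ` {1..} \<subseteq> ?T"
    by (intro image_subsetI) (simp only: atLeast_iff)
  ultimately show ?thesis
    by (rule infinite_super[rotated])
qed

end
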